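(* For every integer $d\ge2$, $(d+1)$-dimensional Minkowski space-time (with $d$ spatial dimensions and one time dimension), regarded as a partially ordered set under its causal order, is a conical poset.
   Context: **Minkowski order.** Points are $(\vec x,t)\in\mathbb R^d\times\mathbb R$, and $(\vec x,t)\preceq(\vec x',t')$ iff $t'\ge t$ and $c^2(t'-t)^2\ge\|\vec x'-\vec x\|^2$, where $c>0$ is the speed of light; so $p\preceq q$ iff $q$ lies in the (closed) future light cone of $p$. **Notation.** For a poset $\mathcal T$ and $x\in\mathcal T$, $\bar J^+(x)=\{b\in\mathcal T: b\succeq x\}$. For finite $L\subset\mathcal T$, $f(L):=\bigcap_{x\in L}\bar J^+(x)$ (with $f(\emptyset)=\mathcal T$). **Span.** For finite $L\subset\mathcal T$, $\mathrm{span}(L)$ is the union of all sets $L'\subseteq L$ such that $f(L')=f(L)$ and there is no $L''\subsetneq L'$ with $f(L'')=f(L)$. **Conical.** $\mathcal T$ is conical if for any two finite subsets $L_i,L_j\subset\mathcal T$, $f(L_i)=f(L_j)$ implies $\mathrm{span}(L_i)=\mathrm{span}(L_j)$. *)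

theory Defs
  imports "HOL-Analysis.Analysis"
begin

text \<open>A poset is given by a carrier \<open>T\<close> and a relation \<open>r\<close>, where \<open>(x, y) \<in> r\<close> means
  that \<open>x\<close> precedes or equals \<open>y\<close>.\<close>

definition future :: "'a set \<Rightarrow> 'a rel \<Rightarrow> 'a \<Rightarrow> 'a set" where
  "future T r x = {b \<in> T. (x, b) \<in> r}"

text \<open>Intersecting with \<open>T\<close> only matters for \<open>L = {}\<close>, where it yields the convention
  that the common future of the empty set is \<open>T\<close>.\<close>

definition common_future :: "'a set \<Rightarrow> 'a rel \<Rightarrow> 'a set \<Rightarrow> 'a set" where
  "common_future T r L = T \<inter> (\<Inter>x\<in>L. future T r x)"

definition causal_span :: "'a set \<Rightarrow> 'a rel \<Rightarrow> 'a set \<Rightarrow> 'a set" where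
  "causal_span T r L =
    \<Union>{L'. L' \<subseteq> L \<and> common_future T r L' = common_future T r L \<and>
          \<not> (\<exists>L''. L'' \<subset> L' \<and> common_future T r L'' = common_future T r L)}"

definition conical_poset :: "'a set \<Rightarrow> 'a rel \<Rightarrow> bool" where
  "conical_poset T r \<longleftrightarrow>
    partial_order_on T r \<and>
    (\<forall>L1 L2. finite L1 \<and> L1 \<subseteq> T \<and> finite L2 \<and> L2 \<subseteq> T \<and>
       common_future T r L1 = common_future T r L2 \<longrightarrow>
       causal_span T r L1 = causal_span T r L2)"

text \<open>A point is a pair of a position in Euclidean space and a time; \<open>c\<close> is the speed of
  light.\<close>

definition minkowski_order :: "real \<Rightarrow> ((real ^ 'n) \<times> real) rel" where
  "minkowski_order c =
    {((x, t), (x', t')). t' \<ge> t \<and> c\<^sup>2 * (t' - t)\<^sup>2 \<ge> (norm (x' - x))\<^sup>2}"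

end

theory Submission
  imports Defs
begin

text \<open>The common future of \<open>L\<close> is the epigraph of the maximum of the cone functions
  \<open>y \<mapsto> t + \<parallel>y - x\<parallel> / c\<close> with \<open>(x, t) \<in> L\<close>. If \<open>L\<close> is minimal, each of its cone
  functions is the strict maximum on a nonempty open set. If \<open>L2\<close> has the same common
  future, then finitely many closed coincidence sets with cone functions of \<open>L2\<close> cover this
  open set, so one of them has nonempty interior. In dimension at least two, cone functions
  agreeing on a nonempty open set have the same apex; hence \<open>L \<subseteq> L2\<close>. So sets with equal
  common future have the same minimal generating subsets.\<close>

text \<open>The time at which light emitted at the event \<open>p\<close> reaches the position
  \<open>y\<close>.\<close>

definition cone_time :: "real \<Rightarrow> ('a::real_normed_vector \<times> real) \<Rightarrow> 'a \<Rightarrow> real" where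
  "cone_time c p y = snd p + norm (y - fst p) / c"

lemma continuous_on_cone_time [continuous_intros]: "continuous_on S (cone_time c p)"
  unfolding cone_time_def divide_inverse by (intro continuous_intros)

text \<open>Square roots can be taken once \<open>t \<le> s\<close>, and for \<open>c > 0\<close>
  the bound \<open>norm (y - x) \<le> c * (s - t)\<close> already forces \<open>t \<le> s\<close>,
  so one inequality replaces both conditions.\<close>

lemma minkowski_order_iff:
  assumes "c > 0"
  shows "(p, b) \<in> minkowski_order c \<longleftrightarrow> cone_time c p (fst b) \<le> snd b"
proof -
  obtain x t y s where [simp]: "p = (x, t)" "b = (y, s)"
    by (metis surj_pair)
  have "(norm (y - x))\<^sup>2 \<le> c\<^sup>2 * (s - t)\<^sup>2 \<longleftrightarrow> norm (y - x) \<le> c * (s - t)" if "t \<le> s"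
    using that assms abs_le_square_iff[of "norm (y - x)" "c * (s - t)"]
    by (simp add: power_mult_distrib abs_mult)
  moreover have "t \<le> s" if "norm (y - x) \<le> c * (s - t)"
    using order_trans[OF norm_ge_zero that] assms by (simp add: zero_le_mult_iff)
  moreover have "cone_time c p y \<le> s \<longleftrightarrow> norm (y - x) \<le> c * (s - t)"
    using assms by (auto simp: cone_time_def field_simps)
  ultimately show ?thesis
    by (auto simp: minkowski_order_def)
qed

lemma partial_order_minkowski_order:
  assumes "c > 0"
  shows "partial_order_on UNIV (minkowski_order c)"
proof -
  have iff: "(p, q) \<in> minkowski_order c \<longleftrightarrow> norm (fst q - fst p) \<le> c * (snd q - snd p)" for p q
    using assms by (auto simp: minkowski_order_iff cone_time_def field_simps)
  have "trans (minkowski_order c)"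
  proof (rule transI)
    fix p q r
    assume "(p, q) \<in> minkowski_order c" "(q, r) \<in> minkowski_order c"
    then show "(p, r) \<in> minkowski_order c"
      using norm_triangle_ineq[of "fst r - fst q" "fst q - fst p"]
      by (simp add: iff algebra_simps)
  qed
  moreover have "antisym (minkowski_order c)"
  proof (rule antisymI)
    fix p q
    assume *: "(p, q) \<in> minkowski_order c" "(q, p) \<in> minkowski_order c"
    then have n: "norm (fst q - fst p) \<le> c * (snd q - snd p)"
        "norm (fst q - fst p) \<le> c * (snd p - snd q)"
      by (simp_all add: iff norm_minus_commute)
    then have "norm (fst q - fst p) \<le> 0"
      unfolding right_diff_distrib by linarith
    moreover have "snd p = snd q"
      using order_trans[OF norm_ge_zero n(1)] order_trans[OF norm_ge_zero n(2)] assms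
      by (simp add: zero_le_mult_iff)
    ultimately show "p = q"
      by (simp add: prod_eq_iff)
  qed
  moreover have "refl (minkowski_order c)"
    by (simp add: refl_on_def iff)
  ultimately show ?thesis
    by (simp add: partial_order_on_def preorder_on_def)
qed

lemma common_future_minkowski_iff:
  assumes "c > 0"
  shows "(y, s) \<in> common_future UNIV (minkowski_order c) L \<longleftrightarrow> (\<forall>p\<in>L. cone_time c p y \<le> s)"
  using assms by (simp add: common_future_def future_def minkowski_order_iff)

text \<open>Squaring the hypothesis cancels the quadratic terms, so \<open>a * norm (w - z)\<close>
  is affine in \<open>w\<close> on \<open>U\<close>; this forces first \<open>a = 0\<close>, then
  \<open>x = z\<close>. On a line the claim fails: on a ray beyond both \<open>x\<close> and
  \<open>z\<close> the two distances differ by a constant.\<close>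

lemma norm_diff_eq_on_open:
  fixes x z :: "'a::euclidean_space"
  assumes dim: "2 \<le> DIM('a)" and "open U" "U \<noteq> {}"
    and eq: "\<And>y. y \<in> U \<Longrightarrow> norm (y - x) = norm (y - z) + a"
  shows "x = z"
proof -
  obtain y where y: "y \<in> U" using assms by blast
  obtain e where e: "e > 0" "ball y e \<subseteq> U"
    using \<open>open U\<close> y openE by blast
  have aff: "(norm x)\<^sup>2 - (norm z)\<^sup>2 - 2 * ((x - z) \<bullet> w) = 2 * a * norm (w - z) + a\<^sup>2"
    if "w \<in> U" for w
  proof -
    have "(norm (w - x))\<^sup>2 = (norm (w - z) + a)\<^sup>2"
      using eq[OF that] by simp
    then have "(norm (w - x))\<^sup>2 - (norm (w - z))\<^sup>2 = 2 * a * norm (w - z) + a\<^sup>2"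
      by (simp add: power2_sum)
    then show ?thesis
      unfolding power2_norm_eq_inner
      by (simp add: algebra_simps inner_commute)
  qed
  \<comment> \<open>Adding \<open>aff\<close> at \<open>y + v\<close> and \<open>y - v\<close> and
    subtracting it twice at \<open>y\<close> cancels the linear terms.\<close>
  have second_diff: "a * (norm (y + v - z) + norm (y - v - z)) = 2 * a * norm (y - z)"
    if "norm v < e" for v
  proof -
    have "y + v \<in> U" "y - v \<in> U"
      using that e(2) by (auto simp: dist_norm subset_eq)
    from aff[OF this(1)] aff[OF this(2)] aff[OF y] show ?thesis
      by (simp add: inner_add_right inner_diff_right distrib_left)
  qed
  \<comment> \<open>By \<open>aff\<close>, if \<open>a \<noteq> 0\<close> then the distance to \<open>z\<close> is affine near \<open>y\<close>. But it grows in
    both directions along a vector orthogonal to \<open>y - z\<close>.\<close>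
  have "a = 0"
  proof (rule ccontr)
    assume "a \<noteq> 0"
    obtain v0 where v0: "v0 \<noteq> 0" "orthogonal (y - z) v0"
      using orthogonal_to_vector_exists[OF dim] by blast
    define v where "v = (e / 2 / norm v0) *\<^sub>R v0"
    have v: "v \<noteq> 0" "norm v < e" "(y - z) \<bullet> v = 0"
      using v0 e by (auto simp: v_def orthogonal_def)
    have *: "norm (y - z + w) > norm (y - z)" if "w \<in> {v, - v}" for w
    proof -
      have "(norm (y - z + w))\<^sup>2 = (norm (y - z))\<^sup>2 + (norm w)\<^sup>2"
        using that v(3) by (intro norm_add_Pythagorean) (auto simp: orthogonal_def)
      moreover have "(norm w)\<^sup>2 > 0"
        using that v(1) by auto
      ultimately show ?thesis
        by (intro power2_less_imp_less[of "norm (y - z)" "norm (y - z + w)"]) auto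
    qed
    have "norm (y + v - z) + norm (y - v - z) = 2 * norm (y - z)"
      using second_diff[OF v(2)] \<open>a \<noteq> 0\<close> by simp
    with *[of v] *[of "- v"] show False
      by (simp add: algebra_simps)
  qed
  show "x = z"
  proof (rule ccontr)
    assume "x \<noteq> z"
    \<comment> \<open>With \<open>a = 0\<close>, \<open>aff\<close> makes the inner product with
      \<open>x - z\<close> constant on \<open>U\<close>, but a step along \<open>x - z\<close>
      itself changes it.\<close>
    define v where "v = (e / 2 / norm (x - z)) *\<^sub>R (x - z)"
    have "norm v < e"
      using \<open>x \<noteq> z\<close> e by (simp add: v_def)
    then have "y + v \<in> U"
      using e(2) by (auto simp: dist_norm subset_eq)
    from aff[OF this] aff[OF y] \<open>a = 0\<close> have "(x - z) \<bullet> v = 0"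
      by (simp add: inner_add_right)
    then show False
      using \<open>x \<noteq> z\<close> e by (simp add: v_def)
  qed
qed

lemma cone_time_eq_on_open:
  fixes p q :: "'a::euclidean_space \<times> real"
  assumes "2 \<le> DIM('a)" "c > 0" "open U" "U \<noteq> {}"
    and eq: "\<And>y. y \<in> U \<Longrightarrow> cone_time c p y = cone_time c q y"
  shows "p = q"
proof -
  have "norm (y - fst p) = norm (y - fst q) + c * (snd q - snd p)" if "y \<in> U" for y
    using eq[OF that] \<open>c > 0\<close> by (simp add: cone_time_def field_simps)
  then have "fst p = fst q"
    using norm_diff_eq_on_open assms(1,3,4) by blast
  moreover from this have "snd p = snd q"
    using eq \<open>U \<noteq> {}\<close> by (auto simp: cone_time_def)
  ultimately show ?thesis
    by (simp add: prod_eq_iff)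
qed

text \<open>A finite form of Baire's theorem. Closedness matters: the rationals and the irrationals
  both have empty interior but cover the line.\<close>

lemma interior_UN_closed_empty_interior:
  assumes "finite I" "\<And>i. i \<in> I \<Longrightarrow> closed (A i)" "\<And>i. i \<in> I \<Longrightarrow> interior (A i) = {}"
  shows "interior (\<Union>i\<in>I. A i) = {}"
  using assms by (induction I) (auto simp: interior_closed_Un_empty_interior)

lemma minimal_subset_of_same_common_future:
  fixes L L2 :: "((real ^ 'n::finite) \<times> real) set"
  assumes "c > 0" "2 \<le> CARD('n)" "finite L" "finite L2"
    and same: "common_future UNIV (minkowski_order c) L2 = common_future UNIV (minkowski_order c) L"
    and minimal: "\<nexists>M. M \<subset> L \<and>
      common_future UNIV (minkowski_order c) M = common_future UNIV (minkowski_order c) L"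
  shows "L \<subseteq> L2"
proof
  fix p assume "p \<in> L"
  let ?f = "common_future UNIV (minkowski_order c) :: ((real ^ 'n) \<times> real) set \<Rightarrow> _"
  note f_iff = common_future_minkowski_iff[OF \<open>c > 0\<close>]
  define U where "U = (\<Inter>q\<in>L - {p}. {y. cone_time c q y < cone_time c p y})"
  have "open U"
    unfolding U_def using \<open>finite L\<close> by (auto intro!: open_Collect_less continuous_intros)
  \<comment> \<open>A point gained by dropping \<open>p\<close> lies on or above all other cones but
    strictly below that of \<open>p\<close>, so its position is in \<open>U\<close>.\<close>
  have "?f (L - {p}) \<noteq> ?f L"
    using minimal \<open>p \<in> L\<close> by blast
  moreover have "?f L \<subseteq> ?f (L - {p})"
    by (auto simp: common_future_def)
  ultimately obtain y0 s0 where "(y0, s0) \<in> ?f (L - {p})" "(y0, s0) \<notin> ?f L"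
    by auto
  then have "\<forall>q\<in>L - {p}. cone_time c q y0 \<le> s0" "s0 < cone_time c p y0"
    unfolding f_iff by (blast, metis DiffI not_le singletonD)
  then have "y0 \<in> U"
    unfolding U_def by force
  have "\<exists>q\<in>L2. cone_time c p y = cone_time c q y" if "y \<in> U" for y
  proof (rule ccontr)
    assume none: "\<not> ?thesis"
    \<comment> \<open>The point over \<open>y\<close> on the cone of \<open>p\<close> is in both
      common futures. If no cone of \<open>L2\<close> passes through it, all of them run strictly
      below, and the point can be lowered without leaving \<open>?f L2\<close>.\<close>
    have "(y, cone_time c p y) \<in> ?f L"
      unfolding f_iff
    proof
      fix q assume "q \<in> L"
      with that show "cone_time c q y \<le> cone_time c p y"
        by (cases "q = p") (auto simp: U_def intro: less_imp_le)
    qed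
    then have "(y, cone_time c p y) \<in> ?f L2"
      using same by simp
    with none have less: "cone_time c q y < cone_time c p y" if "q \<in> L2" for q
      using that unfolding f_iff by (metis order_le_less)
    \<comment> \<open>The inserted element keeps the maximum defined when \<open>L2\<close> is
      empty, and it too lies below the cone of \<open>p\<close>.\<close>
    define s where "s = Max (insert (cone_time c p y - 1) ((\<lambda>q. cone_time c q y) ` L2))"
    have "(y, s) \<in> ?f L2"
      unfolding f_iff s_def using \<open>finite L2\<close> by auto
    then have "cone_time c p y \<le> s"
      using same \<open>p \<in> L\<close> by (simp add: f_iff)
    moreover have "s < cone_time c p y"
      unfolding s_def using \<open>finite L2\<close> less by (subst Max_less_iff) auto
    ultimately show False
      by simp
  qed
  then have "U \<subseteq> (\<Union>q\<in>L2. {y. cone_time c p y = cone_time c q y})"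
    by auto
  then have "interior (\<Union>q\<in>L2. {y. cone_time c p y = cone_time c q y}) \<noteq> {}"
    using \<open>open U\<close> \<open>y0 \<in> U\<close> interior_maximal by blast
  then obtain q where q: "q \<in> L2" "interior {y. cone_time c p y = cone_time c q y} \<noteq> {}"
    using interior_UN_closed_empty_interior[OF \<open>finite L2\<close>,
        of "\<lambda>q. {y. cone_time c p y = cone_time c q y}"]
    by (auto intro!: closed_Collect_eq continuous_intros)
  have "p = q"
    using \<open>2 \<le> CARD('n)\<close> \<open>c > 0\<close> q(2) interior_subset
    by (intro cone_time_eq_on_open[of c "interior {y. cone_time c p y = cone_time c q y}"]) auto
  with q(1) show "p \<in> L2"
    by simp
qed

theorem lemma5p4:
  fixes c :: real
  assumes "c > 0"
    and "CARD('n::finite) \<ge> 2"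
  shows "conical_poset UNIV (minkowski_order c :: ((real ^ 'n) \<times> real) rel)"
proof -
  let ?r = "minkowski_order c :: ((real ^ 'n) \<times> real) rel"
  have "causal_span UNIV ?r L1 \<subseteq> causal_span UNIV ?r L2"
    if "finite L1" "finite L2" "common_future UNIV ?r L1 = common_future UNIV ?r L2" for L1 L2
  proof -
    \<comment> \<open>Minimality refers to \<open>L1\<close> only through its common future, so a
      minimal \<open>L\<close> contained in \<open>L2\<close> is also one of the sets united in the
      span of \<open>L2\<close>.\<close>
    have "L \<subseteq> L2" if "L \<subseteq> L1" "common_future UNIV ?r L = common_future UNIV ?r L1"
        "\<nexists>M. M \<subset> L \<and> common_future UNIV ?r M = common_future UNIV ?r L1" for L
      using minimal_subset_of_same_common_future[of c L L2] that assms
        \<open>finite L1\<close> \<open>finite L2\<close> \<open>common_future UNIV ?r L1 = common_future UNIV ?r L2\<close>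
      by (auto intro: finite_subset)
    then show ?thesis
      using that(3) unfolding causal_span_def by (intro Union_mono) auto
  qed
  then show ?thesis
    unfolding conical_poset_def
    using partial_order_minkowski_order[OF \<open>c > 0\<close>]
    by (intro conjI allI impI subset_antisym) simp_all
qed

end
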